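(* No function of the diameter bounds the expected capture time, even when the cop is permitted to stay put on any move. That is, there is no function $f:\mathbb{N}\to\mathbb{R}$ such that for every finite connected simple undirected graph $G$ and every choice of initial vertices for the cop and the drunk, the infimum over all cop strategies (including strategies that sometimes stay put) of the expected capture time is at most $f(\mathrm{diam}(G))$.
   Context: Game: a cop and a drunk (robber) each occupy a vertex of a graph $G$. A "move" consists of a step by the cop (to an adjacent vertex of her choice, or, in the variant where idling is permitted, possibly remaining at her current vertex), followed by a step by the drunk to a neighbor of his current vertex chosen uniformly at random. The cop sees everything. Capture takes place when the cop lands on the drunk's vertex or vice versa, and the capture time is the number of the move at which this takes place. $\mathrm{diam}(G)$ is the diameter of $G$. *)

theory Defs
  imports "HOL-Probability.Probability" "Graph_Theory.Graph_Theory"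
begin

section \<open>Distance and diameter\<close>

text \<open>
  A finite simple undirected graph is a \<^locale>\<open>pair_graph\<close>: a finite, loop-free digraph
  whose arc set is a symmetric set of ordered pairs. The predicate \<^const>\<open>connected\<close> also
  requires that there is at least one vertex. Every finite graph is isomorphic to one of type
  \<^typ>\<open>nat pair_pre_digraph\<close>.
\<close>

definition graph_dist :: "'a pair_pre_digraph \<Rightarrow> 'a \<Rightarrow> 'a \<Rightarrow> nat" where
  "graph_dist G u v = (LEAST n. \<exists>p. pre_digraph.awalk (with_proj G) u p v \<and> length p = n)"

definition diam :: "'a pair_pre_digraph \<Rightarrow> nat" where
  "diam G = Max {graph_dist G u v | u v. u \<in> pverts G \<and> v \<in> pverts G}"

definition neighbors :: "'a pair_pre_digraph \<Rightarrow> 'a \<Rightarrow> 'a set" where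
  "neighbors G v = {w. (v, w) \<in> parcs G}"


section \<open>The game\<close>

text \<open>
  A state is the pair (position of the cop, position of the drunk) after a move; a history is the
  list of all states from time 0 up to now. A cop strategy sees the whole history and
  may randomize; a deterministic strategy is one that takes values of the form
  \<^term>\<open>return_pmf v\<close>.
\<close>

type_synonym 'a state = "'a \<times> 'a"
type_synonym 'a strategy = "'a state list \<Rightarrow> 'a pmf"

definition cop_strategies :: "'a pair_pre_digraph \<Rightarrow> 'a strategy set" where
  "cop_strategies G = {\<sigma>. \<forall>h. h \<noteq> [] \<and> set h \<subseteq> pverts G \<times> pverts G \<longrightarrow>
     set_pmf (\<sigma> h) \<subseteq> insert (fst (last h)) (neighbors G (fst (last h)))}"

text \<open>
  One move: the cop steps first, and the drunk steps only if the cop has not landed on him. Hence a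
  capture during a move, of either kind, shows up as equality of the two positions after that
  move. In a connected graph the drunk has no neighbor only if the graph has a single vertex; then
  the cop is on the drunk's vertex, and the last branch is not reached.
\<close>

definition move_pmf :: "'a pair_pre_digraph \<Rightarrow> 'a strategy \<Rightarrow> 'a state list \<Rightarrow> 'a state pmf" where
  "move_pmf G \<sigma> h =
     bind_pmf (\<sigma> h) (\<lambda>c'. let r = snd (last h) in
       if c' = r then return_pmf (c', r)
       else map_pmf (\<lambda>r'. (c', r')) (pmf_of_set (neighbors G r)))"

definition state_kernel ::
    "'a pair_pre_digraph \<Rightarrow> 'a strategy \<Rightarrow> 'a \<Rightarrow> 'a \<Rightarrow> nat \<Rightarrow> (nat \<Rightarrow> 'a state) \<Rightarrow> 'a state measure" where
  "state_kernel G \<sigma> c r n \<omega> =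
     measure_pmf (if n = 0 then return_pmf (c, r) else move_pmf G \<sigma> (map \<omega> [0..<n]))"

text \<open>
  The law of the infinite sequence of states, given by the Ionescu-Tulcea theorem. The run
  continues formally after a capture; this does not affect the capture time.
\<close>

definition play :: "'a pair_pre_digraph \<Rightarrow> 'a strategy \<Rightarrow> 'a \<Rightarrow> 'a \<Rightarrow> (nat \<Rightarrow> 'a state) measure" where
  "play G \<sigma> c r =
     projective_family.lim UNIV
       (Ionescu_Tulcea.CI (state_kernel G \<sigma> c r) (\<lambda>_. count_space UNIV))
       (\<lambda>_. count_space UNIV)"

text \<open>The capture time is 0 if both players start on the same vertex, and infinite if the drunk is
  never caught (the infimum of the empty set).\<close>

definition capture_time :: "(nat \<Rightarrow> 'a state) \<Rightarrow> enat" where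
  "capture_time \<omega> = (INF n \<in> {n. fst (\<omega> n) = snd (\<omega> n)}. enat n)"

definition expected_capture_time ::
    "'a pair_pre_digraph \<Rightarrow> 'a strategy \<Rightarrow> 'a \<Rightarrow> 'a \<Rightarrow> ennreal" where
  "expected_capture_time G \<sigma> c r =
     (\<integral>\<^sup>+ \<omega>. ennreal_of_enat (capture_time \<omega>) \<partial>play G \<sigma> c r)"

definition optimal_capture_time :: "'a pair_pre_digraph \<Rightarrow> 'a \<Rightarrow> 'a \<Rightarrow> ennreal" where
  "optimal_capture_time G c r = (INF \<sigma> \<in> cop_strategies G. expected_capture_time G \<sigma> c r)"


section \<open>Well-definedness of the law of the game\<close>

lemma measurable_prefix:
  "(\<lambda>\<omega> :: nat \<Rightarrow> 'a :: countable. map \<omega> [0..<n])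
     \<in> measurable (PiM {0..<n} (\<lambda>_. count_space UNIV)) (count_space UNIV)"
proof (subst measurable_count_space_eq2_countable, intro conjI ballI)
  fix xs :: "'a list"
  let ?M = "PiM {0..<n} (\<lambda>_. count_space (UNIV :: 'a set))"
  show "(\<lambda>\<omega>. map \<omega> [0..<n]) -` {xs} \<inter> space ?M \<in> sets ?M"
  proof (cases "length xs = n")
    case True
    have "map \<omega> [0..<n] = xs \<longleftrightarrow> (\<forall>i\<in>{0..<n}. \<omega> i = xs ! i)" for \<omega> :: "nat \<Rightarrow> 'a"
      unfolding list_eq_iff_nth_eq using True by auto
    then have "(\<lambda>\<omega>. map \<omega> [0..<n]) -` {xs} \<inter> space ?M = PiE {0..<n} (\<lambda>i. {xs ! i})"
      by (auto simp: space_PiM PiE_iff)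
    then show ?thesis
      by (simp add: sets_PiM_I_finite)
  next
    case False
    then have "(\<lambda>\<omega>. map \<omega> [0..<n]) -` {xs} \<inter> space ?M = {}"
      by auto
    then show ?thesis
      by (simp only: sets.empty_sets)
  qed
qed simp_all

lemma Ionescu_Tulcea_state_kernel:
  fixes G :: "'a :: countable pair_pre_digraph"
  shows "Ionescu_Tulcea (state_kernel G \<sigma> c r) (\<lambda>_. count_space UNIV)"
proof (rule Ionescu_Tulcea.intro)
  fix n
  show "state_kernel G \<sigma> c r n
      \<in> measurable (PiM {0..<n} (\<lambda>_. count_space UNIV)) (subprob_algebra (count_space UNIV))"
    unfolding state_kernel_def
    by (rule measurable_compose[OF measurable_prefix measurable_measure_pmf])
next
  fix n x
  show "prob_space (state_kernel G \<sigma> c r n x)"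
    unfolding state_kernel_def by (rule prob_space_measure_pmf)
qed


lemma prob_space_play:
  fixes G :: "'a :: countable pair_pre_digraph"
  shows "prob_space (play G \<sigma> c r)"
proof -
  interpret IT: Ionescu_Tulcea "state_kernel G \<sigma> c r" "\<lambda>_. count_space UNIV"
    by (rule Ionescu_Tulcea_state_kernel)
  have "prob_space (distr IT.PF.lim (PiM {} (\<lambda>_. count_space UNIV)) (\<lambda>x. restrict x {}))"
    by (subst IT.distr_lim) (simp_all add: IT.PF.prob_space_P)
  then show ?thesis
    unfolding play_def
    by (rule prob_space_distrD[rotated])
      (simp add: measurable_cong_sets[OF IT.PF.sets_lim refl] measurable_restrict_subset)
qed

lemma sets_play:
  fixes G :: "'a :: countable pair_pre_digraph"
  shows "sets (play G \<sigma> c r) = sets (PiM UNIV (\<lambda>_. count_space UNIV))"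
proof -
  interpret IT: Ionescu_Tulcea "state_kernel G \<sigma> c r" "\<lambda>_. count_space UNIV"
    by (rule Ionescu_Tulcea_state_kernel)
  show ?thesis
    unfolding play_def by (rule IT.PF.sets_lim)
qed

lemma space_play:
  fixes G :: "'a :: countable pair_pre_digraph"
  shows "space (play G \<sigma> c r) = UNIV"
  using sets_eq_imp_space_eq[OF sets_play, of G \<sigma> c r] by (simp add: space_PiM)

text \<open>The finite-dimensional distributions of the law: the next state is drawn according to
  \<^const>\<open>move_pmf\<close>, given the history.\<close>

lemma emeasure_play_prefix:
  fixes G :: "'a :: countable pair_pre_digraph"
  assumes "length h = n"
  shows "emeasure (play G \<sigma> c r) {\<omega>. map \<omega> [0..<Suc n] = h @ [s]} =
    emeasure (play G \<sigma> c r) {\<omega>. map \<omega> [0..<n] = h} *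
      pmf (if n = 0 then return_pmf (c, r) else move_pmf G \<sigma> h) s"
proof -
  interpret IT: Ionescu_Tulcea "state_kernel G \<sigma> c r" "\<lambda>_. count_space UNIV"
    by (rule Ionescu_Tulcea_state_kernel)
  let ?M = "\<lambda>m. PiM {0..<m} (\<lambda>_ :: nat. count_space (UNIV :: 'a state set))"
  define X where "X m g = (\<lambda>\<omega>. map \<omega> [0..<m]) -` {g} \<inter> space (?M m)" for m and g :: "'a state list"
  define u where "u = (\<lambda>_ :: nat. undefined :: 'a state)"
  have u: "u \<in> space (?M 0)"
    by (simp add: u_def space_PiM)
  have X: "X m g \<in> sets (?M m)" for m g
    unfolding X_def by (rule measurable_sets[OF measurable_prefix]) simp
  have marginal: "emeasure (play G \<sigma> c r) {\<omega>. map \<omega> [0..<m] = g} = emeasure (IT.C 0 m u) (X m g)"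
    for m g
  proof -
    have "{\<omega>. map \<omega> [0..<m] = g} = IT.PF.emb UNIV {0..<m} (X m g)"
      by (auto simp: prod_emb_def X_def space_PiM)
    moreover have "IT.PF.emb {0..<m} {0..<m} (X m g) = X m g"
      using sets.sets_into_space[OF X[of m g]] by (intro prod_emb_id) (auto simp: space_PiM)
    ultimately show ?thesis
      unfolding play_def using X[of m g] IT.emeasure_CI[of "{0..<m}" m "X m g"]
      by (simp add: IT.lim u_def)
  qed
  have "emeasure (IT.C 0 (Suc n) u) (X (Suc n) (h @ [s])) =
      (\<integral>\<^sup>+ x. emeasure (IT.eP n x) (X (Suc n) (h @ [s])) \<partial>IT.C 0 n u)"
    using IT.measurable_eP[of n] IT.space_C[OF u, of n]
    by (simp add: emeasure_bind[OF _ _ X] measurable_cong_sets[OF IT.sets_C[OF u, of n]]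
         prob_space.not_empty[OF IT.prob_space_C[OF u]])
  also have "\<dots> = (\<integral>\<^sup>+ x. indicator (X n h) x *
      ennreal (pmf (if n = 0 then return_pmf (c, r) else move_pmf G \<sigma> h) s) \<partial>IT.C 0 n u)"
  proof (rule nn_integral_cong)
    fix x assume "x \<in> space (IT.C 0 n u)"
    then have x: "x \<in> space (?M n)"
      using IT.space_C[OF u, of n] by simp
    then have upd: "x(n := t) \<in> space (?M (Suc n))" for t
      by (auto simp: space_PiM PiE_iff extensional_def)
    have "emeasure (IT.eP n x) (X (Suc n) (h @ [s])) =
        emeasure (state_kernel G \<sigma> c r n x) {t. x(n := t) \<in> X (Suc n) (h @ [s])}"
      by (simp add: IT.emeasure_eP[OF x X] vimage_def)
    also have "{t. x(n := t) \<in> X (Suc n) (h @ [s])} = (if x \<in> X n h then {s} else {})"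
      using upd x assms by (auto simp: X_def)
    also have "emeasure (state_kernel G \<sigma> c r n x) \<dots> = indicator (X n h) x *
      ennreal (pmf (if n = 0 then return_pmf (c, r) else move_pmf G \<sigma> h) s)"
      by (auto simp: state_kernel_def emeasure_pmf_single X_def)
    finally show "emeasure (IT.eP n x) (X (Suc n) (h @ [s])) = \<dots>" .
  qed
  also have "\<dots> = emeasure (IT.C 0 n u) (X n h) *
      ennreal (pmf (if n = 0 then return_pmf (c, r) else move_pmf G \<sigma> h) s)"
    using IT.sets_C[OF u, of n] X[of n h]
    by (subst nn_integral_multc) (simp_all add: borel_measurable_indicator)
  finally show ?thesis
    by (simp only: marginal)
qed

lemma measurable_capture_time:
  fixes G :: "'a :: countable pair_pre_digraph"
  shows "capture_time \<in> measurable (play G \<sigma> c r) (count_space UNIV)"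
proof -
  have [measurable]: "Measurable.pred (play G \<sigma> c r) (\<lambda>\<omega>. fst (\<omega> n) = snd (\<omega> n))" for n
  proof -
    have "(\<lambda>\<omega>. \<omega> n) \<in> measurable (play G \<sigma> c r) (count_space UNIV)"
      unfolding measurable_cong_sets[OF sets_play refl] by (rule measurable_component_singleton) simp
    from measurable_compose[OF this, of "\<lambda>s. fst s = snd s" "count_space UNIV"] show ?thesis
      by simp
  qed
  have eq: "capture_time = (\<lambda>\<omega> :: nat \<Rightarrow> 'a state. if \<exists>n. fst (\<omega> n) = snd (\<omega> n)
      then enat (LEAST n. fst (\<omega> n) = snd (\<omega> n)) else \<infinity>)"
  proof
    fix \<omega> :: "nat \<Rightarrow> 'a state"
    show "capture_time \<omega> = (if \<exists>n. fst (\<omega> n) = snd (\<omega> n)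
      then enat (LEAST n. fst (\<omega> n) = snd (\<omega> n)) else \<infinity>)"
    proof (cases "\<exists>n. fst (\<omega> n) = snd (\<omega> n)")
      case True
      then have "fst (\<omega> (LEAST n. fst (\<omega> n) = snd (\<omega> n))) = snd (\<omega> (LEAST n. fst (\<omega> n) = snd (\<omega> n)))"
        by (rule LeastI_ex)
      then have "capture_time \<omega> = enat (LEAST n. fst (\<omega> n) = snd (\<omega> n))"
        unfolding capture_time_def
        by (intro antisym INF_lower INF_greatest) (auto intro: Least_le)
      with True show ?thesis by simp
    next
      case False
      then show ?thesis
        by (simp add: capture_time_def top_enat_def)
    qed
  qed
  show ?thesis
    unfolding eq by measurable
qed

end

theory Submission
  imports Defs
begin

text \<open>
  The witnesses are the point-line incidence graphs of the affine plane over a prime field with \<open>p\<close>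
  elements, with the vertical lines removed. Every vertex has \<open>p\<close> neighbors, two distinct vertices
  have at most one neighbor in common, and the graph is bipartite. The diameter is at most 4
  for every \<open>p > 2\<close> (\<open>diam_incidence_graph\<close>).

  Suppose that the drunk is not within reach of the cop's next step. She moves, and he then chooses
  among \<open>p\<close> vertices, of which at most one is on or next to her new vertex
  (\<open>sparse_incidence_graph\<close>). So whatever she does, with probability at least \<open>1 - 1/p\<close> he is still out
  of reach after the move. It follows that he survives \<open>n\<close> moves with probability at least
  \<open>(1 - 1/p)^n\<close>, and the expected capture time is at least \<open>(n + 1) (1 - 1/p)^n\<close>
  (\<open>optimal_capture_time_ge\<close>). For \<open>p\<close> larger than \<open>2n\<close> this is at least \<open>(n + 1)/2\<close>, which is
  unbounded, although the diameter stays below 5.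
\<close>

section \<open>Evading capture in sparse graphs\<close>

text \<open>A state is harmless for the drunk if the cop cannot capture him with her next step. This is the
  condition to keep invariant: from such a state a capture within one move can only come from the
  drunk's own random step.\<close>

definition unthreatened :: "'a pair_pre_digraph \<Rightarrow> 'a state set" where
  "unthreatened G = {(c, r). c \<in> pverts G \<and> r \<in> pverts G \<and> r \<notin> insert c (neighbors G c)}"

text \<open>The drunk, leaving \<open>r\<close>, ends up on or next to the cop's vertex \<open>c\<close> with probability at most
  \<open>\<epsilon>\<close>, wherever she stands other than on \<open>r\<close> itself. The cop's own vertex is counted along with its neighbors because the
  drunk may also run into her.\<close>

definition sparse :: "'a pair_pre_digraph \<Rightarrow> real \<Rightarrow> bool" where
  "sparse G \<epsilon> \<longleftrightarrow> finite (pverts G) \<and> (\<forall>v \<in> pverts G. neighbors G v \<noteq> {} \<and> neighbors G v \<subseteq> pverts G) \<and>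
     (\<forall>c \<in> pverts G. \<forall>r \<in> pverts G. c \<noteq> r \<longrightarrow>
       real (card (neighbors G r \<inter> insert c (neighbors G c))) \<le> \<epsilon> * real (card (neighbors G r)))"

lemma finite_unthreatened: "finite (pverts G) \<Longrightarrow> finite (unthreatened G)"
  by (rule finite_subset[of _ "pverts G \<times> pverts G"]) (auto simp: unthreatened_def)

lemma emeasure_drunk_step:
  assumes G: "sparse G \<epsilon>" and c: "c \<in> pverts G" and r: "r \<in> pverts G" and "c \<noteq> r"
  shows "ennreal (1 - \<epsilon>) \<le>
    emeasure (map_pmf (\<lambda>r'. (c, r')) (pmf_of_set (neighbors G r))) (unthreatened G)"
proof -
  let ?N = "neighbors G r" and ?B = "insert c (neighbors G c)"
  have N: "?N \<noteq> {}" "?N \<subseteq> pverts G" "finite ?N"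
    using G r by (auto simp: sparse_def intro: finite_subset)
  then have pos: "0 < card ?N" by (simp add: card_gt_0_iff)
  have "card ?N = card (?N \<inter> ?B) + card (?N - ?B)"
    by (metis N(3) card_Int_Diff)
  moreover have "real (card (?N \<inter> ?B)) \<le> \<epsilon> * real (card ?N)"
    using G c r \<open>c \<noteq> r\<close> by (auto simp: sparse_def)
  ultimately have "(1 - \<epsilon>) * real (card ?N) \<le> real (card (?N - ?B))"
    by (simp add: algebra_simps)
  then have "1 - \<epsilon> \<le> real (card (?N - ?B)) / real (card ?N)"
    using pos by (simp add: field_simps)
  also have "?N - ?B = ?N \<inter> (\<lambda>r'. (c, r')) -` unthreatened G"
    using N(2) c by (auto simp: unthreatened_def)
  finally have "ennreal (1 - \<epsilon>) \<le> ennreal (card (?N \<inter> (\<lambda>r'. (c, r')) -` unthreatened G) / card ?N)"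
    by (rule ennreal_leI)
  then show ?thesis
    using N by (simp add: emeasure_pmf_of_set)
qed

text \<open>From an unthreatened state every legal step of the cop, staying put included, leads to a vertex
  other than the drunk's. Hence sparseness applies to the outcome of each of her choices, and the
  bound survives averaging over a randomized choice.\<close>

lemma emeasure_move_unthreatened:
  assumes G: "sparse G \<epsilon>" and \<sigma>: "\<sigma> \<in> cop_strategies G"
    and h: "h \<noteq> []" "set h \<subseteq> unthreatened G"
  shows "ennreal (1 - \<epsilon>) \<le> emeasure (move_pmf G \<sigma> h) (unthreatened G)"
proof -
  obtain c r where cr: "last h = (c, r)" by fastforce
  then have "(c, r) \<in> unthreatened G"
    using h last_in_set[of h] by auto
  then have c: "c \<in> pverts G" and r: "r \<in> pverts G" and nr: "r \<notin> insert c (neighbors G c)"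
    by (auto simp: unthreatened_def)
  have "set h \<subseteq> pverts G \<times> pverts G"
    using h(2) by (auto simp: unthreatened_def)
  then have step: "set_pmf (\<sigma> h) \<subseteq> insert c (neighbors G c)"
    using \<sigma> h(1) cr by (force simp: cop_strategies_def)
  let ?K = "\<lambda>c'. let r = snd (last h) in
       if c' = r then return_pmf (c', r)
       else map_pmf (\<lambda>r'. (c', r')) (pmf_of_set (neighbors G r))"
  have "ennreal (1 - \<epsilon>) = (\<integral>\<^sup>+ c'. ennreal (1 - \<epsilon>) \<partial>\<sigma> h)"
    by simp
  also have "\<dots> \<le> (\<integral>\<^sup>+ c'. emeasure (?K c') (unthreatened G) \<partial>\<sigma> h)"
  proof (rule nn_integral_mono_AE, rule AE_pmfI)
    fix c' assume "c' \<in> set_pmf (\<sigma> h)"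
    then have c': "c' \<in> insert c (neighbors G c)" using step by blast
    then have "c' \<in> pverts G" "c' \<noteq> r"
      using G c nr by (auto simp: sparse_def)
    then show "ennreal (1 - \<epsilon>) \<le> emeasure (?K c') (unthreatened G)"
      using emeasure_drunk_step[OF G _ r] by (simp add: cr)
  qed
  also have "\<dots> = emeasure (move_pmf G \<sigma> h) (unthreatened G)"
    by (simp add: move_pmf_def)
  finally show ?thesis .
qed

lemma sets_play_prefix:
  fixes G :: "'a :: countable pair_pre_digraph"
  shows "{\<omega>. map \<omega> [0..<n] = h} \<in> sets (play G \<sigma> c r)"
proof -
  have [measurable]: "(\<lambda>\<omega>. \<omega> i) \<in> measurable (play G \<sigma> c r) (count_space UNIV)" for i
    unfolding measurable_cong_sets[OF sets_play refl] by (rule measurable_component_singleton) simp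
  have eq: "map \<omega> [0..<n] = h \<longleftrightarrow> length h = n \<and> (\<forall>i<n. \<omega> i = h ! i)" for \<omega> :: "nat \<Rightarrow> 'a state"
    unfolding list_eq_iff_nth_eq by auto
  have "{\<omega> \<in> space (play G \<sigma> c r). length h = n \<and> (\<forall>i<n. \<omega> i = h ! i)} \<in> sets (play G \<sigma> c r)"
    by measurable
  then show ?thesis
    by (simp add: eq space_play)
qed

lemma emeasure_play_prefix_in:
  fixes G :: "'a :: countable pair_pre_digraph"
  assumes "finite H"
  shows "emeasure (play G \<sigma> c r) {\<omega>. map \<omega> [0..<n] \<in> H} =
    (\<Sum>h\<in>H. emeasure (play G \<sigma> c r) {\<omega>. map \<omega> [0..<n] = h})"
proof -
  have "{\<omega>. map \<omega> [0..<n] \<in> H} = (\<Union>h\<in>H. {\<omega>. map \<omega> [0..<n] = h})"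
    by auto
  then show ?thesis
    using assms by (simp only:) (intro sum_emeasure[symmetric],
      auto simp: sets_play_prefix disjoint_family_on_def)
qed

text \<open>Conditioning on the history of an unthreatened run, each move preserves the invariant with
  probability at least \<open>1 - \<epsilon>\<close>, so the probabilities multiply. Sparse graphs are finite, so an
  event about the first states is a finite sum over histories and no further measure theory enters.\<close>

lemma emeasure_play_unthreatened:
  fixes G :: "'a :: countable pair_pre_digraph"
  assumes G: "sparse G \<epsilon>" "\<epsilon> \<le> 1" and \<sigma>: "\<sigma> \<in> cop_strategies G"
    and start: "(c, r) \<in> unthreatened G"
  shows "ennreal ((1 - \<epsilon>) ^ n) \<le>
    emeasure (play G \<sigma> c r) {\<omega>. set (map \<omega> [0..<Suc n]) \<subseteq> unthreatened G}"
proof -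
  let ?P = "play G \<sigma> c r" and ?U = "unthreatened G"
  define H where "H m = {h. set h \<subseteq> ?U \<and> length h = m}" for m
  have finU: "finite ?U"
    using G by (intro finite_unthreatened) (simp add: sparse_def)
  then have finH: "finite (H m)" for m
    unfolding H_def by (rule finite_lists_length_eq)
  have H: "{\<omega>. set (map \<omega> [0..<m]) \<subseteq> ?U} = {\<omega>. map \<omega> [0..<m] \<in> H m}" for m
    by (auto simp: H_def)
  have step: "emeasure ?P {\<omega>. map \<omega> [0..<Suc m] \<in> H (Suc m)} =
      (\<Sum>h\<in>H m. emeasure ?P {\<omega>. map \<omega> [0..<m] = h} *
        emeasure (if m = 0 then return_pmf (c, r) else move_pmf G \<sigma> h) ?U)" for m
  proof -
    have "bij_betw (\<lambda>(h, s). h @ [s]) (H m \<times> ?U) (H (Suc m))"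
      by (rule bij_betw_byWitness[where f' = "\<lambda>h. (butlast h, last h)"])
         (auto simp: H_def dest: in_set_butlastD intro!: append_butlast_last_id last_in_set[THEN subsetD[rotated]])
    then have "emeasure ?P {\<omega>. map \<omega> [0..<Suc m] \<in> H (Suc m)} =
        (\<Sum>(h, s)\<in>H m \<times> ?U. emeasure ?P {\<omega>. map \<omega> [0..<Suc m] = h @ [s]})"
      unfolding emeasure_play_prefix_in[OF finH]
      by (subst sum.reindex_bij_betw[symmetric]) (auto intro!: sum.cong)
    also have "\<dots> = (\<Sum>h\<in>H m. \<Sum>s\<in>?U. emeasure ?P {\<omega>. map \<omega> [0..<m] = h} *
        ennreal (pmf (if m = 0 then return_pmf (c, r) else move_pmf G \<sigma> h) s))"
      unfolding sum.cartesian_product[symmetric]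
      by (intro sum.cong refl emeasure_play_prefix) (simp add: H_def)
    finally show ?thesis
      by (simp add: sum_distrib_left[symmetric] emeasure_measure_pmf_finite[OF finU] del: upt_Suc)
  qed
  show ?thesis
    unfolding H
  proof (induction n)
    case 0
    have "H 0 = {[]}" by (auto simp: H_def)
    then show ?case
      using start prob_space.emeasure_space_1[OF prob_space_play[of G \<sigma> c r]]
      by (subst step) (simp add: space_play)
  next
    case (Suc n)
    have "ennreal ((1 - \<epsilon>) ^ Suc n) = ennreal ((1 - \<epsilon>) ^ n) * ennreal (1 - \<epsilon>)"
      using G(2) by (simp add: ennreal_mult mult.commute)
    also have "\<dots> \<le> emeasure ?P {\<omega>. map \<omega> [0..<Suc n] \<in> H (Suc n)} * ennreal (1 - \<epsilon>)"
      by (rule mult_right_mono[OF Suc.IH]) simp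
    also have "\<dots> = (\<Sum>h\<in>H (Suc n). emeasure ?P {\<omega>. map \<omega> [0..<Suc n] = h} * ennreal (1 - \<epsilon>))"
      unfolding emeasure_play_prefix_in[OF finH] by (rule sum_distrib_right)
    also have "\<dots> \<le> (\<Sum>h\<in>H (Suc n). emeasure ?P {\<omega>. map \<omega> [0..<Suc n] = h} *
        emeasure (move_pmf G \<sigma> h) ?U)"
      by (intro sum_mono mult_left_mono emeasure_move_unthreatened[OF G(1) \<sigma>])
        (auto simp: H_def)
    also have "\<dots> = emeasure ?P {\<omega>. map \<omega> [0..<Suc (Suc n)] \<in> H (Suc (Suc n))}"
      by (simp add: step[of "Suc n"] del: upt_Suc)
    finally show ?case .
  qed
qed

text \<open>On the event that the states at times \<open>0, \<dots>, n\<close> are unthreatened the capture time exceeds \<open>n\<close>;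
  Markov's inequality then turns the preceding bound into one on the expectation.\<close>

lemma optimal_capture_time_ge:
  fixes G :: "'a :: countable pair_pre_digraph"
  assumes G: "sparse G \<epsilon>" "\<epsilon> \<le> 1" and start: "(c, r) \<in> unthreatened G"
  shows "of_nat (Suc n) * ennreal ((1 - \<epsilon>) ^ n) \<le> optimal_capture_time G c r"
  unfolding optimal_capture_time_def
proof (rule INF_greatest)
  fix \<sigma> assume \<sigma>: "\<sigma> \<in> cop_strategies G"
  let ?P = "play G \<sigma> c r" and ?A = "{\<omega>. set (map \<omega> [0..<Suc n]) \<subseteq> unthreatened G}"
  \<comment> \<open>The event is a finite union of cylinders, hence measurable.\<close>
  have "finite {h. set h \<subseteq> unthreatened G \<and> length h = Suc n}"
    using G by (intro finite_lists_length_eq finite_unthreatened) (simp add: sparse_def)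
  then have "(\<Union>h\<in>{h. set h \<subseteq> unthreatened G \<and> length h = Suc n}. {\<omega>. map \<omega> [0..<Suc n] = h}) \<in> sets ?P"
    by (intro sets.finite_UN sets_play_prefix)
  also have "(\<Union>h\<in>{h. set h \<subseteq> unthreatened G \<and> length h = Suc n}. {\<omega>. map \<omega> [0..<Suc n] = h}) = ?A"
    by auto
  finally have A: "?A \<in> sets ?P" .
  have "of_nat (Suc n) * ennreal ((1 - \<epsilon>) ^ n) \<le> of_nat (Suc n) * emeasure ?P ?A"
    by (intro mult_left_mono emeasure_play_unthreatened[OF G \<sigma> start]) simp
  also have "\<dots> = (\<integral>\<^sup>+ \<omega>. of_nat (Suc n) * indicator ?A \<omega> \<partial>?P)"
    by (simp only: nn_integral_cmult_indicator[OF A])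
  also have "\<dots> \<le> (\<integral>\<^sup>+ \<omega>. ennreal_of_enat (capture_time \<omega>) \<partial>?P)"
  proof (rule nn_integral_mono)
    fix \<omega> :: "nat \<Rightarrow> 'a state"
    have "enat (Suc n) \<le> capture_time \<omega>" if "\<omega> \<in> ?A"
      unfolding capture_time_def
    proof (rule INF_greatest)
      fix m assume "m \<in> {m. fst (\<omega> m) = snd (\<omega> m)}"
      then have "\<omega> m \<notin> unthreatened G" by (cases "\<omega> m") (auto simp: unthreatened_def)
      moreover have "\<omega> m \<in> unthreatened G" if "m < Suc n"
        using \<open>\<omega> \<in> ?A\<close> that by (auto simp del: upt_Suc)
      ultimately have "\<not> m < Suc n" by blast
      then show "enat (Suc n) \<le> enat m" by simp
    qed
    then have "ennreal_of_enat (enat (Suc n)) \<le> ennreal_of_enat (capture_time \<omega>)" if "\<omega> \<in> ?A"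
      using that by (simp only: ennreal_of_enat_le_iff)
    then show "of_nat (Suc n) * indicator ?A \<omega> \<le> ennreal_of_enat (capture_time \<omega>)"
      by (simp split: split_indicator del: of_nat_Suc)
  qed
  finally show "of_nat (Suc n) * ennreal ((1 - \<epsilon>) ^ n) \<le> expected_capture_time G \<sigma> c r"
    unfolding expected_capture_time_def .
qed

section \<open>Point-line incidences over a prime field\<close>

text \<open>The Boolean tells points from lines. With the line \<open>(m, b)\<close> given by \<open>y + b = x m\<close>, rather than
  \<open>y = m x + b\<close>, points and lines play interchangeable roles, and every argument covers both kinds
  of vertex at once. Vertical lines are left out.\<close>

type_synonym incidence_vertex = "bool \<times> int \<times> int"

definition incidence_vertices :: "int \<Rightarrow> incidence_vertex set" where
  "incidence_vertices p = UNIV \<times> {0..<p} \<times> {0..<p}"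

fun incident :: "int \<Rightarrow> incidence_vertex \<Rightarrow> incidence_vertex \<Rightarrow> bool" where
  "incident p (s, x, y) (t, m, b) \<longleftrightarrow> s \<noteq> t \<and> p dvd y + b - x * m"

definition incidence_graph :: "int \<Rightarrow> nat pair_pre_digraph" where
  "incidence_graph p = \<lparr>pverts = to_nat ` incidence_vertices p,
     parcs = {(to_nat u, to_nat v) |u v. u \<in> incidence_vertices p \<and> v \<in> incidence_vertices p \<and> incident p u v}\<rparr>"

lemma incident_sym: "incident p u v \<longleftrightarrow> incident p v u"
  by (cases u; cases v) (auto simp: algebra_simps)

lemma not_incident_self: "\<not> incident p u u"
  by (cases u) simp

lemma residue_eqI:
  fixes a b p :: int
  assumes "a \<in> {0..<p}" "b \<in> {0..<p}" "p dvd a - b"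
  shows "a = b"
  using assms by (metis atLeastLessThan_iff mod_eq_dvd_iff mod_pos_pos_trivial)

lemma neighbor_at:
  assumes "0 < p"
  shows "incident p (s, x, y) (\<not> s, m, (x * m - y) mod p)"
proof -
  have "p dvd (x * m - y) mod p - (x * m - y)"
    by (simp add: mod_eq_dvd_iff[symmetric])
  then show ?thesis by (simp add: algebra_simps)
qed

text \<open>Through a given point there is exactly one line of each slope.\<close>

lemma card_incident:
  assumes "0 < p"
  shows "card {w \<in> incidence_vertices p. incident p (s, x, y) w} = nat p"
proof -
  have "{w \<in> incidence_vertices p. incident p (s, x, y) w} = (\<lambda>m. (\<not> s, m, (x * m - y) mod p)) ` {0..<p}"
  proof (intro equalityI subsetI)
    fix w assume w: "w \<in> {w \<in> incidence_vertices p. incident p (s, x, y) w}"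
    obtain t m b where w_eq: "w = (t, m, b)" by (cases w)
    from w have "t = (\<not> s)" "m \<in> {0..<p}" "b \<in> {0..<p}" "p dvd b - (x * m - y)"
      by (auto simp: w_eq incidence_vertices_def algebra_simps)
    moreover from this have "b = (x * m - y) mod p"
      by (metis atLeastLessThan_iff mod_eq_dvd_iff mod_pos_pos_trivial)
    ultimately show "w \<in> (\<lambda>m. (\<not> s, m, (x * m - y) mod p)) ` {0..<p}"
      by (auto simp: w_eq)
  qed (use assms neighbor_at in \<open>auto simp: incidence_vertices_def simp del: incident.simps\<close>)
  then show ?thesis
    by (simp add: card_image inj_on_def)
qed

text \<open>Subtracting the four congruences in pairs cancels everything but \<open>(x - x') (m - m')\<close>. As
  \<open>p\<close> is prime, one factor vanishes modulo \<open>p\<close>, and then the two points or the two lines coincide.\<close>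

lemma common_incident_unique:
  assumes "prime p" and V: "u \<in> incidence_vertices p" "v \<in> incidence_vertices p"
      "w \<in> incidence_vertices p" "w' \<in> incidence_vertices p"
    and "u \<noteq> v"
    and inc: "incident p u w" "incident p v w" "incident p u w'" "incident p v w'"
  shows "w = w'"
proof -
  obtain s x y s' x' y' t m b t' m' b' where eqs:
    "u = (s, x, y)" "v = (s', x', y')" "w = (t, m, b)" "w' = (t', m', b')"
    by (metis prod_cases3)
  have sides: "s = s'" "t = t'" using inc by (auto simp: eqs)
  have d: "p dvd y + b - x * m" "p dvd y' + b - x' * m" "p dvd y + b' - x * m'" "p dvd y' + b' - x' * m'"
    using inc by (auto simp: eqs)
  have "p dvd ((y' + b - x' * m) - (y + b - x * m)) + ((y + b' - x * m') - (y' + b' - x' * m'))"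
    by (rule dvd_add[OF dvd_diff[OF d(2,1)] dvd_diff[OF d(3,4)]])
  then have "p dvd (x - x') * (m - m')"
    by (simp add: algebra_simps)
  then consider "p dvd x - x'" | "p dvd m - m'"
    using \<open>prime p\<close> by (auto simp: prime_dvd_mult_iff)
  then show ?thesis
  proof cases
    case 1
    then have "x = x'" using V by (intro residue_eqI[of _ p]) (auto simp: eqs incidence_vertices_def)
    moreover from this have "p dvd y - y'" using dvd_diff[OF d(1,2)] by simp
    then have "y = y'" using V by (intro residue_eqI[of _ p]) (auto simp: eqs incidence_vertices_def)
    ultimately show ?thesis using \<open>u \<noteq> v\<close> sides by (simp add: eqs)
  next
    case 2
    then have "m = m'" using V by (intro residue_eqI[of _ p]) (auto simp: eqs incidence_vertices_def)
    moreover from this have "p dvd b - b'" using dvd_diff[OF d(1,3)] by simp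
    then have "b = b'" using V by (intro residue_eqI[of _ p]) (auto simp: eqs incidence_vertices_def)
    ultimately show ?thesis using sides by (simp add: eqs)
  qed
qed

text \<open>The slope of the line through the two points is \<open>(y - y') / (x - x')\<close>, with the inverse modulo
  \<open>p\<close> taken from a Bezout identity.\<close>

lemma common_incident_exists:
  assumes p: "prime p" and x: "x \<in> {0..<p}" "x' \<in> {0..<p}" "x \<noteq> x'"
  shows "\<exists>w \<in> incidence_vertices p. incident p (s, x, y) w \<and> incident p w (s, x', y')"
proof -
  have "0 < p" using p by (simp add: prime_gt_0_int)
  have "\<not> p dvd x - x'" using x residue_eqI by blast
  then have "coprime p (x - x')" using p by (simp add: prime_imp_coprime)
  then obtain a e where ae: "a * p + e * (x - x') = 1"
    using bezout_int[of p "x - x'"] by auto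
  define m where "m = e * (y - y') mod p"
  define b where "b = (x * m - y) mod p"
  have 1: "incident p (s, x, y) (\<not> s, m, b)"
    unfolding b_def by (rule neighbor_at) fact
  have "p dvd e * (y - y') - m"
    unfolding m_def by (simp add: mod_eq_dvd_iff[symmetric])
  then have "p dvd (x - x') * (e * (y - y') - m) + p * (a * (y - y'))"
    by (intro dvd_add dvd_mult dvd_triv_left)
  also have "(x - x') * (e * (y - y') - m) + p * (a * (y - y')) =
      (a * p + e * (x - x')) * (y - y') - (x - x') * m"
    by (simp add: algebra_simps)
  finally have "p dvd (y - y') - (x - x') * m"
    by (simp add: ae)
  moreover have "p dvd y + b - x * m" using 1 by simp
  ultimately have "p dvd (y + b - x * m) - ((y - y') - (x - x') * m)"
    by (rule dvd_diff[rotated])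
  then have "incident p (s, x', y') (\<not> s, m, b)"
    by (simp add: algebra_simps)
  moreover have "(\<not> s, m, b) \<in> incidence_vertices p"
    using \<open>0 < p\<close> by (simp add: incidence_vertices_def m_def b_def)
  ultimately show ?thesis
    using 1 incident_sym by blast
qed

declare incident.simps [simp del]

lemma pverts_incidence_graph: "pverts (incidence_graph p) = to_nat ` incidence_vertices p"
  by (simp add: incidence_graph_def)

lemma arc_incidence_graph:
  assumes "u \<in> incidence_vertices p" "v \<in> incidence_vertices p" "incident p u v"
  shows "(to_nat u, to_nat v) \<in> parcs (incidence_graph p)"
  using assms by (auto simp: incidence_graph_def simp del: split_paired_Ex)

lemma neighbors_incidence_graph:
  "u \<in> incidence_vertices p \<Longrightarrow>
    neighbors (incidence_graph p) (to_nat u) = to_nat ` {w \<in> incidence_vertices p. incident p u w}"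
  by (auto simp: neighbors_def incidence_graph_def simp del: split_paired_Ex)

lemma finite_incidence_vertices: "finite (incidence_vertices p)"
  by (simp add: incidence_vertices_def)

lemma pair_graph_incidence_graph: "pair_graph (incidence_graph p)"
proof
  show "finite (parcs (incidence_graph p))"
    by (rule finite_subset[of _ "pverts (incidence_graph p) \<times> pverts (incidence_graph p)"])
      (auto simp: incidence_graph_def finite_incidence_vertices)
  show "symmetric (with_proj (incidence_graph p))"
    unfolding symmetric_def
  proof (rule symI)
    fix a b assume "(a, b) \<in> arcs_ends (with_proj (incidence_graph p))"
    then obtain u v where "a = to_nat u" "b = to_nat v"
      "u \<in> incidence_vertices p" "v \<in> incidence_vertices p" "incident p u v"
      by (auto simp: incidence_graph_def)
    then show "(b, a) \<in> arcs_ends (with_proj (incidence_graph p))"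
      using incident_sym by (simp add: arc_incidence_graph)
  qed
qed (auto simp: incidence_graph_def finite_incidence_vertices not_incident_self)

text \<open>If the cop and the drunk stand on vertices of the same kind, the drunk's next vertex is of the
  other kind and threatened only if it is a common neighbor of the two, of which there is at most one. If they stand on
  different kinds, the drunk steps to a vertex of the cop's kind, which is never adjacent to her, so
  the only bad step is the one onto her vertex.\<close>

lemma sparse_incidence_graph:
  assumes p: "prime p"
  shows "sparse (incidence_graph p) (1 / p)"
proof -
  let ?V = "incidence_vertices p"
  have "0 < p" using p by (simp add: prime_gt_0_int)
  have deg: "card (neighbors (incidence_graph p) (to_nat u)) = nat p" if "u \<in> ?V" for u
    using that card_incident[OF \<open>0 < p\<close>]
    by (cases u) (simp add: neighbors_incidence_graph card_image)
  have "card (neighbors (incidence_graph p) (to_nat r) \<inter>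
      insert (to_nat c) (neighbors (incidence_graph p) (to_nat c))) \<le> 1"
    if "c \<in> ?V" "r \<in> ?V" "c \<noteq> r" for c r
  proof -
    let ?B = "{w \<in> ?V. incident p r w \<and> (w = c \<or> incident p c w)}"
    have "w = w'" if "w \<in> ?B" "w' \<in> ?B" for w w'
    proof (cases "fst c = fst r")
      case True
      then have "incident p c w" "incident p c w'"
        using that by (cases c; cases r; cases w; cases w'; auto simp: incident.simps)+
      then show ?thesis
        using common_incident_unique[OF p, of c r w w'] that \<open>c \<in> ?V\<close> \<open>r \<in> ?V\<close> \<open>c \<noteq> r\<close> by auto
    next
      case False
      then have "w = c" "w' = c"
        using that by (cases c; cases r; cases w; cases w'; auto simp: incident.simps)+
      then show ?thesis by simp
    qed
    then have "card ?B \<le> 1"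
      by (auto simp: card_le_Suc0_iff_eq finite_incidence_vertices)
    moreover have "neighbors (incidence_graph p) (to_nat r) \<inter>
        insert (to_nat c) (neighbors (incidence_graph p) (to_nat c)) = to_nat ` ?B"
      using that by (auto simp: neighbors_incidence_graph)
    ultimately show ?thesis by (simp add: card_image)
  qed
  then have "real (card (neighbors (incidence_graph p) (to_nat r) \<inter>
      insert (to_nat c) (neighbors (incidence_graph p) (to_nat c)))) \<le>
      1 / p * real (card (neighbors (incidence_graph p) (to_nat r)))"
    if "c \<in> ?V" "r \<in> ?V" "c \<noteq> r" for c r
    using that deg[of r] \<open>0 < p\<close> by fastforce
  moreover have "neighbors (incidence_graph p) (to_nat u) \<noteq> {}" if "u \<in> ?V" for u
    using deg[OF that] \<open>0 < p\<close> by force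
  moreover have "neighbors (incidence_graph p) (to_nat u) \<subseteq> to_nat ` ?V" if "u \<in> ?V" for u
    using that by (auto simp: neighbors_incidence_graph)
  ultimately show ?thesis
    by (simp add: sparse_def pverts_incidence_graph finite_incidence_vertices)
qed

text \<open>Vertices of the same kind with different first coordinates are at distance 2. For equal first
  coordinates a detour over a third one costs 4 steps; for vertices of different kinds, one step
  to a neighbor with a suitable first coordinate reduces to the former case.\<close>

lemma awalk_incidence_graph:
  assumes "u \<in> incidence_vertices p" "v \<in> incidence_vertices p" "2 < p" and p: "prime p"
  shows "\<exists>q. pre_digraph.awalk (with_proj (incidence_graph p)) (to_nat u) q (to_nat v) \<and> length q \<le> 4"
proof -
  interpret pair_graph "incidence_graph p" by (rule pair_graph_incidence_graph)
  let ?V = "incidence_vertices p"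
  have two: "\<exists>q. awalk (to_nat (s, x, y)) q (to_nat (s, x', y')) \<and> length q = 2"
    if xy: "(s, x, y) \<in> ?V" "(s, x', y') \<in> ?V" "x \<noteq> x'" for s x y x' y'
  proof -
    have "x \<in> {0..<p}" "x' \<in> {0..<p}" using xy by (auto simp: incidence_vertices_def)
    then obtain w where w: "w \<in> ?V" "incident p (s, x, y) w" "incident p w (s, x', y')"
      using common_incident_exists[OF p _ _ \<open>x \<noteq> x'\<close>] by blast
    then have arcs: "(to_nat (s, x, y), to_nat w) \<in> parcs (incidence_graph p)"
        "(to_nat w, to_nat (s, x', y')) \<in> parcs (incidence_graph p)"
      using xy by (simp_all only: arc_incidence_graph)
    then show ?thesis
      by (intro exI[of _ "[(to_nat (s, x, y), to_nat w), (to_nat w, to_nat (s, x', y'))]"])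
        (simp add: awalk_simps in_arcsD2)
  qed
  obtain s x y t x' y' where uv: "u = (s, x, y)" "v = (t, x', y')"
    by (metis prod_cases3)
  show ?thesis
  proof (cases "s = t")
    case True
    obtain z :: int where "z \<in> {0, 1, 2}" and zx: "z \<noteq> x" "z \<noteq> x'"
    proof -
      have "\<exists>z \<in> {0, 1, 2}. z \<noteq> x \<and> z \<noteq> x'" by auto
      then show thesis using that by blast
    qed
    then have z: "z \<in> {0..<p}" using \<open>2 < p\<close> by auto
    then have w: "(s, z, 0) \<in> ?V" by (simp add: incidence_vertices_def)
    from two[of s x y z 0] obtain q1 where q1: "awalk (to_nat u) q1 (to_nat (s, z, 0 :: int))" "length q1 = 2"
      using w zx assms by (auto simp: uv)
    from two[of s z 0 x' y'] obtain q2 where q2: "awalk (to_nat (s, z, 0 :: int)) q2 (to_nat v)" "length q2 = 2"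
      using w zx assms True by (auto simp: uv)
    show ?thesis
      by (rule exI[of _ "q1 @ q2"]) (use q1 q2 in auto)
  next
    case False
    obtain z where z: "z \<in> {0..<p}" "z \<noteq> x'"
      using \<open>2 < p\<close> by (cases "x' = 0") (auto intro: that[of 0] that[of 1])
    define w where "w = (\<not> s, z, (x * z - y) mod p)"
    have w: "w \<in> ?V" "incident p u w"
      using z \<open>2 < p\<close> neighbor_at[of p s x y z] by (auto simp: w_def uv incidence_vertices_def)
    from two[of t z "(x * z - y) mod p" x' y'] obtain q where
      q: "awalk (to_nat w) q (to_nat v)" "length q = 2"
      using w z assms False by (auto simp: uv w_def)
    show ?thesis
      by (rule exI[of _ "(to_nat u, to_nat w) # q"])
        (use q w assms in \<open>auto simp: awalk_simps arc_incidence_graph\<close>)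
  qed
qed

lemma diam_incidence_graph:
  assumes "prime p" "2 < p"
  shows "diam (incidence_graph p) \<le> 4"
proof -
  let ?G = "incidence_graph p"
  let ?D = "{graph_dist ?G u v |u v. u \<in> pverts ?G \<and> v \<in> pverts ?G}"
  have "?D = (\<lambda>(u, v). graph_dist ?G u v) ` (pverts ?G \<times> pverts ?G)" by auto
  then have "finite ?D" by (simp add: pverts_incidence_graph finite_incidence_vertices)
  moreover have "(True, 0, 0) \<in> incidence_vertices p" using assms by (simp add: incidence_vertices_def)
  then have "?D \<noteq> {}" by (auto simp: pverts_incidence_graph)
  moreover have "d \<le> 4" if "d \<in> ?D" for d
  proof -
    from that obtain u v where "u \<in> incidence_vertices p" "v \<in> incidence_vertices p"
      "d = graph_dist ?G (to_nat u) (to_nat v)"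
      by (auto simp: pverts_incidence_graph)
    moreover from this obtain q where
      "pre_digraph.awalk (with_proj ?G) (to_nat u) q (to_nat v)" "length q \<le> 4"
      using awalk_incidence_graph assms by blast
    ultimately show ?thesis
      unfolding graph_dist_def by (auto intro: Least_le[THEN order_trans])
  qed
  ultimately show ?thesis
    unfolding diam_def by (rule Max.boundedI)
qed

lemma connected_incidence_graph:
  assumes "prime p" "2 < p"
  shows "connected (with_proj (incidence_graph p))"
proof -
  interpret pair_graph "incidence_graph p" by (rule pair_graph_incidence_graph)
  have "(\<Union>e\<in>parcs (incidence_graph p). {(fst e, snd e), (snd e, fst e)}) = parcs (incidence_graph p)"
    using arcs_symmetric by fastforce
  then have "mk_symmetric (with_proj (incidence_graph p)) = incidence_graph p"
    by (simp add: mk_symmetric_def)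
  moreover have "(True, 0, 0) \<in> incidence_vertices p" using assms by (simp add: incidence_vertices_def)
  moreover have "u \<rightarrow>\<^sup>*\<^bsub>with_proj (incidence_graph p)\<^esub> v"
    if "u \<in> pverts (incidence_graph p)" "v \<in> pverts (incidence_graph p)" for u v
  proof -
    from that obtain u' v' where "u' \<in> incidence_vertices p" "v' \<in> incidence_vertices p"
      and uv: "u = to_nat u'" "v = to_nat v'"
      unfolding pverts_incidence_graph by blast
    then show ?thesis
      using awalk_incidence_graph[of u' p v'] assms unfolding reachable_awalk uv by blast
  qed
  ultimately show ?thesis
    unfolding connected_def by (auto simp: pverts_incidence_graph intro!: strongly_connectedI)
qed

section \<open>Unboundedness in terms of the diameter\<close>

theorem mainTheorem2:
  shows "\<not> (\<exists>f :: nat \<Rightarrow> real. \<forall>G :: nat pair_pre_digraph.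
    pair_graph G \<and> connected (with_proj G) \<longrightarrow>
    (\<forall>c \<in> pverts G. \<forall>r \<in> pverts G.
      enn2ereal (optimal_capture_time G c r) \<le> ereal (f (diam G))))"
proof
  assume "\<exists>f :: nat \<Rightarrow> real. \<forall>G :: nat pair_pre_digraph.
    pair_graph G \<and> connected (with_proj G) \<longrightarrow>
    (\<forall>c \<in> pverts G. \<forall>r \<in> pverts G.
      enn2ereal (optimal_capture_time G c r) \<le> ereal (f (diam G)))"
  then obtain f :: "nat \<Rightarrow> real" where f: "\<And>(G :: nat pair_pre_digraph) c r.
      \<lbrakk>pair_graph G; connected (with_proj G); c \<in> pverts G; r \<in> pverts G\<rbrakk> \<Longrightarrow>
      enn2ereal (optimal_capture_time G c r) \<le> ereal (f (diam G))"
    by blast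
  \<comment> \<open>The diameter is only known to be at most 4, so all values of \<open>f\<close> up to there must be beaten.\<close>
  define M where "M = Max (f ` {..4})"
  obtain n :: nat where n: "2 * M < n" using reals_Archimedean2 by blast
  \<comment> \<open>With \<open>p \<ge> 2n\<close>, Bernoulli's inequality keeps \<open>(1 - 1/p)^n\<close> at 1/2 or more.\<close>
  obtain q :: nat where q: "prime q" "2 * n + 2 < q" using bigger_prime by blast
  define p where "p = int q"
  have p: "prime p" "2 < p" using q by (auto simp: p_def)
  let ?G = "incidence_graph p" and ?c = "to_nat (True, 0::int, 0::int)" and ?r = "to_nat (True, 1::int, 0::int)"
  have start: "(?c, ?r) \<in> unthreatened ?G"
    using p(2) by (auto simp: unthreatened_def pverts_incidence_graph neighbors_incidence_graph incidence_vertices_def incident.simps)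
  have "1 / 2 \<le> 1 - real n * (1 / p)"
    using q by (simp add: p_def field_simps)
  also have "\<dots> \<le> (1 - 1 / p) ^ n"
    using Bernoulli_inequality[of "- (1 / real_of_int p)" n] p(2) by simp
  finally have half: "1 / 2 \<le> (1 - 1 / real_of_int p) ^ n" .
  have "ereal M < ereal (Suc n * (1 / 2))"
    using n by simp
  also have "\<dots> \<le> ereal (Suc n * (1 - 1 / p) ^ n)"
    using half by (intro ereal_less_eq(3)[THEN iffD2] mult_left_mono) auto
  also have "\<dots> = enn2ereal (of_nat (Suc n) * ennreal ((1 - 1 / p) ^ n))"
    using p(2) by (simp add: ennreal_mult enn2ereal_ennreal ennreal_of_nat_eq_real_of_nat flip: ennreal_mult del: of_nat_Suc)
  also have "\<dots> \<le> enn2ereal (optimal_capture_time ?G ?c ?r)"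
    using optimal_capture_time_ge[OF sparse_incidence_graph[OF p(1)] _ start, of n] p(2)
    by (simp add: less_eq_ennreal.rep_eq del: of_nat_Suc)
  also have "\<dots> \<le> ereal (f (diam ?G))"
    using start by (intro f pair_graph_incidence_graph connected_incidence_graph p) (auto simp: unthreatened_def)
  also have "f (diam ?G) \<le> M"
    unfolding M_def using diam_incidence_graph[OF p] by (intro Max_ge) auto
  finally show False by simp
qed

end
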